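(* Let $R$ be a finite commutative ring with identity and $P$ a proper prime ideal of $R$ with $|P|\geq 2$; let $I=I(\Gamma_P(R))\subseteq S=k[x_1,\ldots,x_a,y_1,\ldots,y_b]$ be the edge ideal of the prime ideal graph. For every integer $n\geq 1$, the ideal $I^n$ has linear quotients.
   Context: The prime ideal graph $\Gamma_P(R)$ is the simple graph with vertex set $R\setminus\{0\}$ in which two distinct vertices $x,y$ are adjacent if and only if $xy\in P$. Put $a=|P|-1$ and $b=|P|(|R/P|-1)=|R\setminus P|$. Write $P\setminus\{0\}=\{u_1,\ldots,u_a\}$, $R\setminus P=\{v_1,\ldots,v_b\}$; attach the variable $x_i$ to $u_i$ and $y_\ell$ to $v_\ell$. Let $k$ be a field and $S=k[x_1,\ldots,x_a,y_1,\ldots,y_b]$. The edge ideal $I=I(\Gamma_P(R))$ is the ideal of $S$ generated by the products of the two variables attached to the endpoints of each edge; explicitly $I=(x_ix_j,\;x_iy_\ell \mid 1\leq i<j\leq a,\;1\leq i\leq a,\;1\leq \ell\leq b)$. A monomial ideal $L$ has linear quotients if its minimal monomial generators can be ordered $g_1,\ldots,g_t$ so that for each $2\leq j\leq t$ the colon ideal $(g_1,\ldots,g_{j-1}):g_j$ is generated by a subset of the variables. *)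

theory Defs
  imports "HOL-Library.Poly_Mapping" "HOL-Algebra.Ideal_Product"
begin

section \<open>Polynomial rings with a prescribed set of variables\<close>

text \<open>
  A monomial in variables of type \<open>'v\<close> is an exponent function \<open>'v \<Rightarrow>\<^sub>0 nat\<close>, and a polynomial
  is a finitely supported function from monomials to coefficients. The ring operations are those
  of the type \<open>('v \<Rightarrow>\<^sub>0 nat) \<Rightarrow>\<^sub>0 'k\<close>; \<open>poly_ring V\<close> is the subring of
  polynomials in which only variables from \<open>V\<close> occur, packaged as a record so that the notions
  of HOL-Algebra (generated ideals, products and powers of ideals) apply to it.
\<close>

type_synonym ('v, 'k) mpoly = "('v \<Rightarrow>\<^sub>0 nat) \<Rightarrow>\<^sub>0 'k"

definition poly_ring :: "'v set \<Rightarrow> ('v, 'k::comm_ring_1) mpoly ring" where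
  "poly_ring V =
     \<lparr>carrier = {p. \<forall>m \<in> Poly_Mapping.keys p. Poly_Mapping.keys m \<subseteq> V},
      mult = (*), one = 1, zero = 0, add = (+)\<rparr>"

definition mvar :: "'v \<Rightarrow> ('v, 'k::comm_ring_1) mpoly" where
  "mvar v = Poly_Mapping.single (Poly_Mapping.single v 1) 1"

definition monomials :: "'v set \<Rightarrow> ('v, 'k::comm_ring_1) mpoly set" where
  "monomials V = {Poly_Mapping.single m 1 | m. Poly_Mapping.keys m \<subseteq> V}"

lemma poly_ring_simps:
  "p \<in> carrier (poly_ring V) \<longleftrightarrow> (\<forall>m \<in> Poly_Mapping.keys p. Poly_Mapping.keys m \<subseteq> V)"
  "p \<otimes>\<^bsub>poly_ring V\<^esub> q = p * q" "\<one>\<^bsub>poly_ring V\<^esub> = 1"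
  "p \<oplus>\<^bsub>poly_ring V\<^esub> q = p + q" "\<zero>\<^bsub>poly_ring V\<^esub> = 0"
  by (simp_all add: poly_ring_def)

lemma cring_poly_ring: "cring (poly_ring V :: ('v, 'k::comm_ring_1) mpoly ring)"
proof -
  let ?S = "poly_ring V :: ('v, 'k) mpoly ring"
  have add_closed: "p + q \<in> carrier ?S" if "p \<in> carrier ?S" "q \<in> carrier ?S" for p q
    using that keys_add[of p q] unfolding poly_ring_simps by blast
  have mult_closed: "p * q \<in> carrier ?S" if pq: "p \<in> carrier ?S" "q \<in> carrier ?S" for p q
    unfolding poly_ring_simps
  proof
    fix m assume "m \<in> Poly_Mapping.keys (p * q)"
    then obtain a b where ab: "m = a + b" "a \<in> Poly_Mapping.keys p" "b \<in> Poly_Mapping.keys q"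
      using keys_mult[of p q] by blast
    then have "Poly_Mapping.keys a \<subseteq> V" "Poly_Mapping.keys b \<subseteq> V"
      using pq unfolding poly_ring_simps by blast+
    then show "Poly_Mapping.keys m \<subseteq> V"
      using keys_add[of a b] ab(1) by blast
  qed
  have uminus_closed: "- p \<in> carrier ?S" if "p \<in> carrier ?S" for p
    using that by (simp add: poly_ring_simps)
  have zero_closed: "0 \<in> carrier ?S" and one_closed: "1 \<in> carrier ?S"
    by (simp_all add: poly_ring_simps)
  show ?thesis
  proof (rule cringI)
    show "abelian_group ?S"
    proof (rule abelian_groupI, unfold poly_ring_simps(2-5))
      fix p assume "p \<in> carrier ?S"
      then show "\<exists>q \<in> carrier ?S. q + p = 0"
        using uminus_closed by (intro bexI[of _ "- p"]) simp_all
    qed (use add_closed zero_closed in \<open>simp_all only: add.assoc add.commute add.left_commute add_0_left add_0_right\<close>)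
    show "comm_monoid ?S"
      by (rule comm_monoidI, unfold poly_ring_simps(2-5))
        (use mult_closed one_closed in \<open>simp_all only: mult.assoc mult.commute mult.left_commute mult_1_left mult_1_right\<close>)
    show "(p \<oplus>\<^bsub>?S\<^esub> q) \<otimes>\<^bsub>?S\<^esub> r = p \<otimes>\<^bsub>?S\<^esub> r \<oplus>\<^bsub>?S\<^esub> q \<otimes>\<^bsub>?S\<^esub> r" for p q r
      unfolding poly_ring_simps by (rule distrib_right)
  qed
qed

section \<open>Linear quotients\<close>

text \<open>The colon ideal \<open>J : g\<close> of an ideal by an element.\<close>

definition ideal_colon :: "('a, 'b) ring_scheme \<Rightarrow> 'a set \<Rightarrow> 'a \<Rightarrow> 'a set" where
  "ideal_colon S J g = {f \<in> carrier S. f \<otimes>\<^bsub>S\<^esub> g \<in> J}"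

definition minimal_monomial_generators ::
    "'v set \<Rightarrow> ('v, 'k::comm_ring_1) mpoly set \<Rightarrow> ('v, 'k) mpoly set \<Rightarrow> bool" where
  "minimal_monomial_generators V L G \<longleftrightarrow>
     G \<subseteq> monomials V \<and> Idl\<^bsub>poly_ring V\<^esub> G = L \<and> (\<forall>H. H \<subset> G \<longrightarrow> Idl\<^bsub>poly_ring V\<^esub> H \<noteq> L)"

text \<open>
  The ordering of the generators is a list without repetitions. List positions count from \<open>0\<close>, so
  \<open>take j gs\<close> are the generators preceding \<open>gs ! j\<close>, and the first generator carries no condition.
\<close>

definition has_linear_quotients :: "'v set \<Rightarrow> ('v, 'k::comm_ring_1) mpoly set \<Rightarrow> bool" where
  "has_linear_quotients V L \<longleftrightarrow>
     (\<exists>gs. distinct gs \<and> minimal_monomial_generators V L (set gs) \<and>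
        (\<forall>j. 1 \<le> j \<and> j < length gs \<longrightarrow>
           (\<exists>W \<subseteq> V. ideal_colon (poly_ring V) (Idl\<^bsub>poly_ring V\<^esub> (set (take j gs))) (gs ! j)
                    = Idl\<^bsub>poly_ring V\<^esub> (mvar ` W))))"

section \<open>The prime ideal graph and its edge ideal\<close>

text \<open>A simple graph is given by its vertex set and its set of two-element edges.\<close>

definition prime_ideal_graph_verts :: "('a, 'b) ring_scheme \<Rightarrow> 'a set" where
  "prime_ideal_graph_verts R = carrier R - {\<zero>\<^bsub>R\<^esub>}"

definition prime_ideal_graph_edges :: "('a, 'b) ring_scheme \<Rightarrow> 'a set \<Rightarrow> 'a set set" where
  "prime_ideal_graph_edges R P =
     {{x, y} | x y. x \<in> prime_ideal_graph_verts R \<and> y \<in> prime_ideal_graph_verts R \<and>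
                    x \<noteq> y \<and> x \<otimes>\<^bsub>R\<^esub> y \<in> P}"

text \<open>The variables are indexed by the vertices themselves.\<close>

definition edge_ideal :: "'v set \<Rightarrow> 'v set set \<Rightarrow> ('v, 'k::comm_ring_1) mpoly set" where
  "edge_ideal V E = Idl\<^bsub>poly_ring V\<^esub> {mvar u * mvar v | u v. {u, v} \<in> E}"

end

theory Submission
  imports Defs "HOL-Library.List_Lexorder"
begin

text \<open>
  Since \<open>P\<close> is prime, two nonzero ring elements have their product in \<open>P\<close> exactly when one of them
  lies in \<open>P\<close>. So the graph is complete multipartite: the complement of \<open>P\<close> is one independent
  block, every nonzero element of \<open>P\<close> is a block by itself, and the edges join different blocks.

  For a complete multipartite graph, a monomial is a product of \<open>n\<close> edges if and only if it has
  degree \<open>2n\<close> and each block contributes degree at most \<open>n\<close>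
  (\<open>power_exps_Suc\<close>). Necessity holds because an edge meets a block at most once. For sufficiency,
  split off an edge between the two heaviest blocks; no third block can carry degree \<open>n\<close>,
  because the total is only \<open>2n\<close>.

  The upper bounds are imposed on disjoint sets of variables, so these exponent vectors form the
  bases of a discrete polymatroid: if \<open>a\<close> exceeds \<open>g\<close> at \<open>v\<close>, then some \<open>w\<close> where \<open>g\<close> exceeds \<open>a\<close>
  can be exchanged for \<open>v\<close> in \<open>g\<close>, choosing \<open>w\<close> in the block of \<open>v\<close> when that block is
  full (\<open>power_exps_polymatroidal\<close>).

  Polymatroidal ideals have linear quotients with respect to the decreasing lexicographic order
  (\<open>polymatroidal_linear_quotients\<close>). If \<open>a\<close> precedes \<open>g\<close> and \<open>v\<close> is the first variable where they
  differ, exchanging at \<open>v\<close> turns \<open>g\<close> into a generator that also precedes \<open>g\<close> and divides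
  \<open>x\<^sub>v g\<close>. Hence \<open>x\<^sub>v\<close> lies in the colon ideal, and it divides every monomial multiplier carrying \<open>g\<close>
  into the ideal generated by \<open>a\<close>.
\<close>

section \<open>Monomials\<close>

abbreviation mono_of :: "('v \<Rightarrow>\<^sub>0 nat) \<Rightarrow> ('v, 'k::comm_ring_1) mpoly" where
  "mono_of m \<equiv> Poly_Mapping.single m 1"

abbreviation exps :: "'v set \<Rightarrow> ('v \<Rightarrow>\<^sub>0 nat) set" where
  "exps V \<equiv> {m. Poly_Mapping.keys m \<subseteq> V}"

abbreviation divides :: "('v \<Rightarrow>\<^sub>0 nat) \<Rightarrow> ('v \<Rightarrow>\<^sub>0 nat) \<Rightarrow> bool" (infix \<open>divides\<close> 50) where
  "a divides m \<equiv> Poly_Mapping.lookup a \<le> Poly_Mapping.lookup m"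

definition unit_exp :: "'v \<Rightarrow> ('v \<Rightarrow>\<^sub>0 nat)" where
  "unit_exp v = Poly_Mapping.single v 1"

definition wt :: "'v set \<Rightarrow> ('v \<Rightarrow>\<^sub>0 nat) \<Rightarrow> nat" where
  "wt A m = (\<Sum>v\<in>A. Poly_Mapping.lookup m v)"

lemma lookup_unit_exp: "Poly_Mapping.lookup (unit_exp v) u = (if u = v then 1 else 0)"
  by (simp add: unit_exp_def lookup_single when_def)

lemma keys_unit_exp [simp]: "Poly_Mapping.keys (unit_exp v) = {v}"
  by (simp add: unit_exp_def)

lemma mvar_eq_mono: "mvar v = mono_of (unit_exp v)"
  by (simp add: mvar_def unit_exp_def)

lemma divides_decompose: "a divides m \<Longrightarrow> m = a + (m - a)"
  by (rule poly_mapping_eqI) (simp add: lookup_add lookup_minus le_fun_def)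

lemma divides_add: "a divides a + b"
  by (simp add: le_fun_def lookup_add)

lemma keys_plus: "Poly_Mapping.keys (a + b) = Poly_Mapping.keys a \<union> Poly_Mapping.keys b"
  for a b :: "'v \<Rightarrow>\<^sub>0 nat"
  by (auto simp: in_keys_iff lookup_add)

lemma unit_exp_divides_iff: "unit_exp v divides m \<longleftrightarrow> 0 < Poly_Mapping.lookup m v"
  by (auto simp: le_fun_def lookup_unit_exp Suc_le_eq)

lemma wt_add: "wt A (a + b) = wt A a + wt A b"
  by (simp add: wt_def lookup_add sum.distrib)

lemma wt_unit_exp: "finite A \<Longrightarrow> wt A (unit_exp v) = (if v \<in> A then 1 else 0)"
  by (simp add: wt_def lookup_unit_exp)

text \<open>
  Pigeonhole for exponents: if \<open>a\<close> is no heavier than \<open>g\<close> on \<open>A\<close>, a surplus of \<open>a\<close> at one variable of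
  \<open>A\<close> has to be compensated elsewhere in \<open>A\<close>. The exchange variables come from here.
\<close>

lemma wt_le_exchange:
  assumes "finite A" "wt A a \<le> wt A g" "v \<in> A" "Poly_Mapping.lookup g v < Poly_Mapping.lookup a v"
  obtains w where "w \<in> A" "Poly_Mapping.lookup a w < Poly_Mapping.lookup g w"
proof -
  have "\<exists>w\<in>A. Poly_Mapping.lookup a w < Poly_Mapping.lookup g w"
  proof (rule ccontr)
    assume "\<not> ?thesis"
    then have "wt A g < wt A a"
      unfolding wt_def using assms by (intro sum_strict_mono_ex1) (auto simp: not_less)
    then show False
      using assms(2) by simp
  qed
  then show ?thesis
    using that by blast
qed

lemma divides_same_wt_eq:
  assumes "finite V" "a \<in> exps V" "m \<in> exps V" "wt V a = wt V m" "a divides m"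
  shows "a = m"
proof (rule poly_mapping_eqI)
  fix v
  show "Poly_Mapping.lookup a v = Poly_Mapping.lookup m v"
  proof (cases "v \<in> V")
    case True
    then show ?thesis
      using wt_le_exchange[of V m a v] assms by (metis le_funD le_less not_le order.refl)
  next
    case False
    then have "Poly_Mapping.lookup a v = 0" "Poly_Mapping.lookup m v = 0"
      using assms(2,3) by (auto simp: in_keys_iff)
    then show ?thesis by simp
  qed
qed

section \<open>Monomial ideals\<close>

text \<open>
  The monomial ideal generated by the monomials with exponents in \<open>A\<close>, described by its elements
  instead of by generators: this form reduces products and colons of ideals to divisibility of
  exponents.
\<close>

definition multiples :: "'v set \<Rightarrow> ('v \<Rightarrow>\<^sub>0 nat) set \<Rightarrow> ('v, 'k::comm_ring_1) mpoly set" where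
  "multiples V A = {p \<in> carrier (poly_ring V). \<forall>m \<in> Poly_Mapping.keys p. \<exists>a \<in> A. a divides m}"

lemma multiples_divisor: "p \<in> multiples V A \<Longrightarrow> m \<in> Poly_Mapping.keys p \<Longrightarrow> \<exists>a\<in>A. a divides m"
  by (simp add: multiples_def)

lemma multiples_carrier: "p \<in> multiples V A \<Longrightarrow> p \<in> carrier (poly_ring V)"
  by (simp add: multiples_def)

lemma sum_of_terms: "p = (\<Sum>m\<in>Poly_Mapping.keys p. Poly_Mapping.single m (Poly_Mapping.lookup p m))"
proof (rule poly_mapping_eqI)
  fix k
  show "Poly_Mapping.lookup p k =
    Poly_Mapping.lookup (\<Sum>m\<in>Poly_Mapping.keys p. Poly_Mapping.single m (Poly_Mapping.lookup p m)) k"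
    by (auto simp: lookup_sum lookup_single when_def in_keys_iff)
qed

text \<open>
  Multiplication by a monomial shifts the support without any cancellation, which is what makes
  colon ideals by monomials computable one term at a time.
\<close>

lemma keys_mult_mono:
  fixes p :: "('v, 'k::comm_ring_1) mpoly"
  shows "Poly_Mapping.keys (p * mono_of g) = (\<lambda>m. m + g) ` Poly_Mapping.keys p"
proof
  show "Poly_Mapping.keys (p * mono_of g) \<subseteq> (\<lambda>m. m + g) ` Poly_Mapping.keys p"
    using keys_mult[of p "mono_of g"] by auto
  have "Poly_Mapping.lookup (p * mono_of g) (m + g) = Poly_Mapping.lookup p m" for m
  proof -
    have "p * mono_of g =
      (\<Sum>k\<in>Poly_Mapping.keys p. Poly_Mapping.single (k + g) (Poly_Mapping.lookup p k))"
      by (subst sum_of_terms[of p]) (simp add: sum_distrib_right mult_single)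
    then show ?thesis
      by (auto simp: lookup_sum lookup_single when_def in_keys_iff)
  qed
  then show "(\<lambda>m. m + g) ` Poly_Mapping.keys p \<subseteq> Poly_Mapping.keys (p * mono_of g)"
    by (auto simp: in_keys_iff)
qed

lemma mono_in_multiples_iff:
  assumes "g \<in> exps V"
  shows "(mono_of g :: ('v, 'k::comm_ring_1) mpoly) \<in> multiples V A \<longleftrightarrow> (\<exists>a\<in>A. a divides g)"
  using assms by (simp add: multiples_def poly_ring_simps)

lemma multiples_ideal: "ideal (multiples V A :: ('v, 'k::comm_ring_1) mpoly set) (poly_ring V)"
proof -
  let ?S = "poly_ring V :: ('v, 'k) mpoly ring"
  let ?M = "multiples V A :: ('v, 'k) mpoly set"
  interpret S: cring ?S by (rule cring_poly_ring)
  have sub: "?M \<subseteq> carrier ?S"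
    by (auto simp: multiples_def)
  have mult: "q * p \<in> ?M" if q: "q \<in> carrier ?S" and p: "p \<in> ?M" for p q
  proof -
    have "\<exists>a\<in>A. a divides m" if m: "m \<in> Poly_Mapping.keys (q * p)" for m
    proof -
      obtain s t where st: "m = s + t" "t \<in> Poly_Mapping.keys p"
        using keys_mult[of q p] m by blast
      obtain a where "a \<in> A" "a divides t"
        using multiples_divisor[OF p st(2)] by blast
      then show ?thesis
        using st by (force simp: le_fun_def lookup_add intro: trans_le_add2)
    qed
    moreover have "q * p \<in> carrier ?S"
      using S.m_closed[of q p] q p sub by (auto simp: poly_ring_simps(2))
    ultimately show ?thesis
      by (simp add: multiples_def)
  qed
  have add: "p + q \<in> ?M" if "p \<in> ?M" "q \<in> ?M" for p q
  proof -
    have "p + q \<in> carrier ?S"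
      using S.a_closed[of p q] that sub by (auto simp: poly_ring_simps(4))
    then show ?thesis
      using that keys_add[of p q] unfolding multiples_def by blast
  qed
  show ?thesis
  proof (rule idealI[OF S.ring_axioms])
    show "subgroup ?M (add_monoid ?S)"
    proof (rule S.add.subgroupI)
      show "?M \<subseteq> carrier ?S" by (rule sub)
      have "0 \<in> ?M"
        by (simp add: multiples_def poly_ring_simps)
      then show "?M \<noteq> {}"
        by blast
      show "\<ominus>\<^bsub>?S\<^esub> p \<in> ?M" if "p \<in> ?M" for p
      proof -
        have c: "p \<in> carrier ?S" "- p \<in> carrier ?S"
          using subsetD[OF sub that] by (simp_all add: poly_ring_simps)
        have "\<ominus>\<^bsub>?S\<^esub> p = - p"
          by (rule S.minus_equality) (use c in \<open>simp_all add: poly_ring_simps\<close>)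
        then show ?thesis
          using that c by (simp add: multiples_def)
      qed
      show "p \<oplus>\<^bsub>?S\<^esub> q \<in> ?M" if "p \<in> ?M" "q \<in> ?M" for p q
        using add[OF that] by (simp add: poly_ring_simps)
    qed
    show "q \<otimes>\<^bsub>?S\<^esub> p \<in> ?M" "p \<otimes>\<^bsub>?S\<^esub> q \<in> ?M" if "p \<in> ?M" "q \<in> carrier ?S" for p q
      using mult[OF that(2,1)] by (simp_all add: poly_ring_simps(2) mult.commute)
  qed
qed

lemma Idl_mono:
  assumes A: "A \<subseteq> exps V"
  shows "Idl\<^bsub>poly_ring V\<^esub> (mono_of ` A) = (multiples V A :: ('v, 'k::comm_ring_1) mpoly set)"
proof
  let ?S = "poly_ring V :: ('v, 'k) mpoly ring"
  interpret S: cring ?S by (rule cring_poly_ring)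
  show "Idl\<^bsub>?S\<^esub> (mono_of ` A) \<subseteq> multiples V A"
    using A by (intro S.genideal_minimal[OF multiples_ideal]) (auto intro!: mono_in_multiples_iff[THEN iffD2])
  have sub: "mono_of ` A \<subseteq> carrier ?S"
    using A by (auto simp: poly_ring_simps)
  interpret J: ideal "Idl\<^bsub>?S\<^esub> (mono_of ` A)" ?S
    by (rule S.genideal_ideal[OF sub])
  show "multiples V A \<subseteq> Idl\<^bsub>?S\<^esub> (mono_of ` A)"
  proof
    fix p :: "('v, 'k) mpoly" assume p: "p \<in> multiples V A"
    have single: "Poly_Mapping.single m c \<in> Idl\<^bsub>?S\<^esub> (mono_of ` A)"
      if m: "m \<in> Poly_Mapping.keys p" for m c
    proof -
      obtain a where a: "a \<in> A" "a divides m"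
        using multiples_divisor[OF p m] by blast
      have "m = (m - a) + a"
        using divides_decompose[OF a(2)] by (simp add: add.commute)
      then have eq: "Poly_Mapping.single m c = Poly_Mapping.single (m - a) c * mono_of a"
        by (simp add: mult_single)
      have "Poly_Mapping.keys m \<subseteq> V"
        using p m by (auto simp: multiples_def poly_ring_simps)
      then have "Poly_Mapping.single (m - a) c \<in> carrier ?S"
        using \<open>m = (m - a) + a\<close> keys_plus[of "m - a" a] by (auto simp: poly_ring_simps)
      then show ?thesis
        using J.I_l_closed[of "mono_of a" "Poly_Mapping.single (m - a) c"] S.genideal_self[OF sub] a(1)
        unfolding eq by (auto simp: poly_ring_simps(2))
    qed
    have "(\<Sum>m\<in>K. Poly_Mapping.single m (Poly_Mapping.lookup p m)) \<in> Idl\<^bsub>?S\<^esub> (mono_of ` A)"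
      if "finite K" "K \<subseteq> Poly_Mapping.keys p" for K
      using that
    proof (induction rule: finite_induct)
      case empty
      then show ?case using J.zero_closed by (simp add: poly_ring_simps)
    next
      case (insert m K)
      then show ?case using J.a_closed[OF single] by (simp add: poly_ring_simps(4))
    qed
    then show "p \<in> Idl\<^bsub>?S\<^esub> (mono_of ` A)"
      using sum_of_terms[of p] by (metis finite_keys order.refl)
  qed
qed

lemma ideal_prod_multiples:
  assumes "A \<subseteq> exps V" "B \<subseteq> exps V"
  shows "ideal_prod (poly_ring V) (multiples V A) (multiples V B)
    = (multiples V {a + b | a b. a \<in> A \<and> b \<in> B} :: ('v, 'k::comm_ring_1) mpoly set)"
    (is "?L = multiples V ?C")
proof
  let ?S = "poly_ring V :: ('v, 'k) mpoly ring"
  interpret S: cring ?S by (rule cring_poly_ring)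
  interpret M: ideal "multiples V ?C :: ('v, 'k) mpoly set" ?S by (rule multiples_ideal)
  have prod_closed: "p * q \<in> multiples V ?C"
    if p: "p \<in> multiples V A" and q: "q \<in> multiples V B" for p q :: "('v, 'k) mpoly"
  proof -
    have "\<exists>c\<in>?C. c divides m" if m: "m \<in> Poly_Mapping.keys (p * q)" for m
    proof -
      obtain s t where st: "m = s + t" "s \<in> Poly_Mapping.keys p" "t \<in> Poly_Mapping.keys q"
        using keys_mult[of p q] m by blast
      obtain a where a: "a \<in> A" "a divides s"
        using multiples_divisor[OF p st(2)] by blast
      obtain b where b: "b \<in> B" "b divides t"
        using multiples_divisor[OF q st(3)] by blast
      have "(a + b) divides m"
        using a(2) b(2) by (simp add: st(1) le_fun_def lookup_add add_mono)
      then show ?thesis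
        using a(1) b(1) by blast
    qed
    moreover have "p * q \<in> carrier ?S"
      using S.m_closed[OF multiples_carrier[OF p] multiples_carrier[OF q]]
      by (simp only: poly_ring_simps(2))
    ultimately show ?thesis
      unfolding multiples_def by blast
  qed
  show "?L \<subseteq> multiples V ?C"
  proof
    fix r assume "r \<in> ?L"
    then show "r \<in> multiples V ?C"
    proof (induction rule: ideal_prod.induct)
      case (prod i j)
      then show ?case using prod_closed[of i j] by (simp add: poly_ring_simps(2))
    next
      case (sum s1 s2)
      then show ?case by (intro M.a_closed)
    qed
  qed
  have C: "?C \<subseteq> exps V"
    using assms by (force simp: keys_plus)
  have "mono_of ` ?C \<subseteq> ?L"
  proof
    fix x :: "('v, 'k) mpoly" assume "x \<in> mono_of ` ?C"
    then obtain a b where ab: "a \<in> A" "b \<in> B" "x = mono_of (a + b)"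
      by blast
    have "(mono_of a :: ('v, 'k) mpoly) \<in> multiples V A" "(mono_of b :: ('v, 'k) mpoly) \<in> multiples V B"
      using ab assms by (auto intro!: mono_in_multiples_iff[THEN iffD2])
    then show "x \<in> ?L"
      using ideal_prod.prod[of "mono_of a" _ "mono_of b" _ ?S] ab(3) by (simp add: poly_ring_simps(2) mult_single)
  qed
  then show "multiples V ?C \<subseteq> ?L"
    unfolding Idl_mono[OF C, symmetric]
    by (intro S.genideal_minimal S.ideal_prod_is_ideal multiples_ideal)
qed

text \<open>
  The colon of a monomial ideal by a monomial is again a monomial ideal, so it is generated by
  the variables in \<open>W\<close> as soon as these generate the right monomials.
\<close>

lemma colon_multiples:
  fixes V :: "'v set"
  assumes g: "g \<in> exps V"
    and W: "\<And>k. k \<in> exps V \<Longrightarrow> (\<exists>a\<in>A. a divides k + g) \<longleftrightarrow> (\<exists>v\<in>W. 0 < Poly_Mapping.lookup k v)"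
    and WV: "W \<subseteq> V"
  shows "ideal_colon (poly_ring V) (multiples V A) (mono_of g)
    = Idl\<^bsub>poly_ring V\<^esub> (mvar ` W :: ('v, 'k::comm_ring_1) mpoly set)"
proof -
  let ?S = "poly_ring V :: ('v, 'k) mpoly ring"
  interpret S: cring ?S by (rule cring_poly_ring)
  have "mvar ` W = (mono_of ` unit_exp ` W :: ('v, 'k) mpoly set)"
    by (simp add: image_image mvar_eq_mono)
  then have "Idl\<^bsub>?S\<^esub> (mvar ` W) = multiples V (unit_exp ` W)"
    using WV by (simp only:) (rule Idl_mono, auto)
  moreover have "f \<in> ideal_colon ?S (multiples V A) (mono_of g) \<longleftrightarrow> f \<in> multiples V (unit_exp ` W)" for f
  proof (cases "f \<in> carrier ?S")
    case f: True
    have "mono_of g \<in> carrier ?S"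
      using g by (simp add: poly_ring_simps)
    then have fg: "f * mono_of g \<in> carrier ?S"
      using S.m_closed[of f "mono_of g"] f by (simp add: poly_ring_simps(2))
    have exp: "k \<in> exps V" if "k \<in> Poly_Mapping.keys f" for k
      using f that by (simp add: poly_ring_simps)
    have "f \<in> ideal_colon ?S (multiples V A) (mono_of g) \<longleftrightarrow>
      (\<forall>k\<in>Poly_Mapping.keys f. \<exists>a\<in>A. a divides k + g)"
      using f fg by (simp add: ideal_colon_def multiples_def poly_ring_simps(2) keys_mult_mono)
    also have "\<dots> \<longleftrightarrow> (\<forall>k\<in>Poly_Mapping.keys f. \<exists>v\<in>W. unit_exp v divides k)"
      using W exp by (simp add: unit_exp_divides_iff)
    finally show ?thesis
      using f by (simp add: multiples_def)
  qed (simp add: ideal_colon_def multiples_def)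
  ultimately show ?thesis
    by blast
qed

section \<open>Polymatroidal ideals have linear quotients\<close>

text \<open>
  The set of bases of a discrete polymatroid of rank \<open>d\<close>, in the dual form of the exchange
  property: the variable \<open>v\<close> that enters \<open>g\<close> is prescribed, the variable \<open>w\<close> that leaves is found.
  The new exponent is \<open>g + e\<^sub>v - e\<^sub>w\<close>, written without the truncated subtraction.
\<close>

definition polymatroidal :: "'v set \<Rightarrow> nat \<Rightarrow> ('v \<Rightarrow>\<^sub>0 nat) set \<Rightarrow> bool" where
  "polymatroidal V d B \<longleftrightarrow> B \<subseteq> exps V \<and> (\<forall>g\<in>B. wt V g = d) \<and>
     (\<forall>g\<in>B. \<forall>a\<in>B. \<forall>v. Poly_Mapping.lookup g v < Poly_Mapping.lookup a v \<longrightarrow>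
        (\<exists>w. Poly_Mapping.lookup a w < Poly_Mapping.lookup g w \<and>
           (\<exists>b\<in>B. b + unit_exp w = g + unit_exp v)))"

lemma map_lookup_less_iff:
  "map (Poly_Mapping.lookup g) vs < map (Poly_Mapping.lookup a) vs \<longleftrightarrow>
     (\<exists>i<length vs. (\<forall>l<i. Poly_Mapping.lookup g (vs ! l) = Poly_Mapping.lookup a (vs ! l)) \<and>
        Poly_Mapping.lookup g (vs ! i) < Poly_Mapping.lookup a (vs ! i))"
proof -
  have "take i (map (Poly_Mapping.lookup g) vs) = take i (map (Poly_Mapping.lookup a) vs) \<longleftrightarrow>
    (\<forall>l<i. Poly_Mapping.lookup g (vs ! l) = Poly_Mapping.lookup a (vs ! l))" if "i < length vs" for i
    using that by (auto simp: list_eq_iff_nth_eq)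
  then show ?thesis
    unfolding list_less_def lexord_take_index_conv by auto
qed

lemma inj_on_map_lookup: "inj_on (\<lambda>m. map (Poly_Mapping.lookup m) vs) (exps (set vs))"
proof (rule inj_onI)
  fix a m :: "'a \<Rightarrow>\<^sub>0 nat"
  assume am: "a \<in> exps (set vs)" "m \<in> exps (set vs)"
    "map (Poly_Mapping.lookup a) vs = map (Poly_Mapping.lookup m) vs"
  show "a = m"
  proof (rule poly_mapping_eqI)
    fix v
    show "Poly_Mapping.lookup a v = Poly_Mapping.lookup m v"
    proof (cases "v \<in> set vs")
      case False
      then have "v \<notin> Poly_Mapping.keys a" "v \<notin> Poly_Mapping.keys m"
        using am by blast+
      then show ?thesis by (simp add: in_keys_iff)
    qed (use am in simp)
  qed
qed

lemma finite_exps_wt: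
  assumes "finite V"
  shows "finite {m \<in> exps V. wt V m = d}"
proof -
  obtain vs where vs: "set vs = V"
    using finite_list[OF assms] by blast
  have "Poly_Mapping.lookup m v \<le> d" if "wt V m = d" "v \<in> V" for m v
    using that member_le_sum[of v V "Poly_Mapping.lookup m"] assms by (auto simp: wt_def)
  then have "(\<lambda>m. map (Poly_Mapping.lookup m) vs) ` {m \<in> exps V. wt V m = d}
    \<subseteq> {xs. set xs \<subseteq> {..d} \<and> length xs = length vs}"
    using vs by auto
  then have "finite ((\<lambda>m. map (Poly_Mapping.lookup m) vs) ` {m \<in> exps V. wt V m = d})"
    by (rule finite_subset) (simp add: finite_lists_length_eq)
  then show ?thesis
    by (rule finite_imageD) (rule inj_on_subset[OF inj_on_map_lookup], use vs in auto)
qed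

lemma list_decreasing_key:
  fixes f :: "'c \<Rightarrow> 'd::linorder"
  assumes "finite A" "inj_on f A"
  obtains xs where "distinct xs" "set xs = A" "sorted_wrt (\<lambda>x y. f y < f x) xs"
proof
  define ys where "ys = rev (sorted_list_of_set (f ` A))"
  define xs where "xs = map (inv_into A f) ys"
  have ys: "set ys = f ` A" "distinct ys"
    using assms(1) by (simp_all add: ys_def)
  show "distinct xs"
    using ys by (simp add: xs_def distinct_map inj_on_inv_into)
  show "set xs = A"
    using ys(1) assms(2) by (simp add: xs_def inv_into_image_cancel)
  have "sorted_wrt (\<lambda>x y. y < x) ys"
    by (simp add: ys_def sorted_wrt_rev)
  then have "sorted_wrt (\<lambda>x y. f (inv_into A f y) < f (inv_into A f x)) ys"
    by (rule sorted_wrt_mono_rel[rotated]) (use ys(1) in \<open>auto simp: assms(2)\<close>)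
  then show "sorted_wrt (\<lambda>x y. f y < f x) xs"
    by (simp add: xs_def sorted_wrt_map)
qed

lemma set_take_decreasing_key:
  assumes "sorted_wrt (\<lambda>x y. f y < f x) xs" "j < length xs"
  shows "set (take j xs) = {x \<in> set xs. f (xs ! j) < (f x :: 'd::linorder)}"
proof -
  have less_iff: "f (xs ! j) < f (xs ! i) \<longleftrightarrow> i < j" if "i < length xs" for i
    using sorted_wrt_nth_less[OF assms(1), of i j] sorted_wrt_nth_less[OF assms(1), of j i] that assms(2)
    by (metis linorder_neqE_nat order.asym order.irrefl)
  have "set (take j xs) = {xs ! i | i. i < j}"
    using assms(2) nth_image[of j xs] by (simp only: less_imp_le) fastforce
  also have "\<dots> = {x \<in> set xs. f (xs ! j) < f x}"
    using less_iff assms(2) by (auto simp: set_conv_nth)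
  finally show ?thesis .
qed

text \<open>
  Monomials of equal degree never properly divide each other, so no generator is redundant.
\<close>

lemma minimal_monomial_generators_mono:
  assumes V: "finite V" and B: "B \<subseteq> exps V" and wt: "\<And>g. g \<in> B \<Longrightarrow> wt V g = d"
  shows "minimal_monomial_generators V (multiples V B :: ('v, 'k::comm_ring_1) mpoly set) (mono_of ` B)"
  unfolding minimal_monomial_generators_def
proof (intro conjI allI impI)
  show "mono_of ` B \<subseteq> monomials V"
    using B by (auto simp: monomials_def)
  show "Idl\<^bsub>poly_ring V\<^esub> (mono_of ` B :: ('v, 'k) mpoly set) = multiples V B"
    by (rule Idl_mono[OF B])
  fix H :: "('v, 'k) mpoly set" assume H: "H \<subset> mono_of ` B"
  then obtain g where g: "g \<in> B" "mono_of g \<notin> H"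
    by blast
  define A where "A = {a \<in> B. (mono_of a :: ('v, 'k) mpoly) \<in> H}"
  have HA: "H = mono_of ` A"
    using H by (auto simp: A_def)
  have AB: "A \<subseteq> B" and gA: "g \<notin> A"
    using g by (auto simp: A_def)
  have "(mono_of g :: ('v, 'k) mpoly) \<notin> multiples V A"
  proof
    assume "(mono_of g :: ('v, 'k) mpoly) \<in> multiples V A"
    then obtain a where a: "a \<in> A" "a divides g"
      using g B by (subst (asm) mono_in_multiples_iff) auto
    then have "a = g"
      using divides_same_wt_eq[OF V, of a g] AB B g wt by (metis subsetD)
    then show False
      using a gA by simp
  qed
  moreover have "(mono_of g :: ('v, 'k) mpoly) \<in> multiples V B"
    using g B by (subst mono_in_multiples_iff) auto
  moreover have "Idl\<^bsub>poly_ring V\<^esub> H = multiples V A"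
    unfolding HA by (rule Idl_mono) (use AB B in blast)
  ultimately show "Idl\<^bsub>poly_ring V\<^esub> H \<noteq> multiples V B"
    by metis
qed

theorem polymatroidal_linear_quotients:
  assumes V: "finite V" and B: "polymatroidal V d B"
  shows "has_linear_quotients V (multiples V B :: ('v, 'k::comm_ring_1) mpoly set)"
proof -
  have BV: "B \<subseteq> exps V" and wt: "\<And>g. g \<in> B \<Longrightarrow> wt V g = d"
    using B by (auto simp: polymatroidal_def)
  obtain vs where vs: "set vs = V" "distinct vs"
    using finite_distinct_list[OF V] by blast
  define key where "key = (\<lambda>m::'v \<Rightarrow>\<^sub>0 nat. map (Poly_Mapping.lookup m) vs)"
  have "finite B"
    by (rule finite_subset[OF _ finite_exps_wt[OF V, of d]]) (use BV wt in blast)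
  moreover have "inj_on key B"
    unfolding key_def by (rule inj_on_subset[OF inj_on_map_lookup]) (use BV vs in blast)
  ultimately obtain es where es: "distinct es" "set es = B" "sorted_wrt (\<lambda>x y. key y < key x) es"
    by (rule list_decreasing_key)
  \<comment> \<open>The first variable \<open>v\<close> where \<open>g\<close> falls behind the earlier \<open>a\<close> lies in the colon ideal of \<open>g\<close>
    and divides the multiplier \<open>k\<close>.\<close>
  have exchange: "\<exists>v\<in>V. 0 < Poly_Mapping.lookup k v \<and> (\<exists>b\<in>B. key g < key b \<and> b divides g + unit_exp v)"
    if g: "g \<in> B" and a: "a \<in> B" "key g < key a" "a divides k + g" for g a k
  proof -
    obtain i where i: "i < length vs"
      "\<And>l. l < i \<Longrightarrow> Poly_Mapping.lookup g (vs ! l) = Poly_Mapping.lookup a (vs ! l)"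
      "Poly_Mapping.lookup g (vs ! i) < Poly_Mapping.lookup a (vs ! i)"
      using a(2) unfolding key_def map_lookup_less_iff by blast
    define v where "v = vs ! i"
    obtain w b where w: "Poly_Mapping.lookup a w < Poly_Mapping.lookup g w"
      and b: "b \<in> B" "b + unit_exp w = g + unit_exp v"
      using B g a(1) i(3) unfolding polymatroidal_def v_def by meson
    have "w \<noteq> v"
      using w i(3) by (auto simp: v_def)
    have look: "Poly_Mapping.lookup b u + (if u = w then 1 else 0) =
        Poly_Mapping.lookup g u + (if u = v then 1 else 0)" for u
      using arg_cong[OF b(2), of "\<lambda>m. Poly_Mapping.lookup m u"]
      by (simp add: lookup_add lookup_unit_exp)
    have "Poly_Mapping.lookup g (vs ! l) = Poly_Mapping.lookup b (vs ! l)" if l: "l < i" for l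
    proof -
      have "vs ! l \<noteq> v"
        using l i(1) vs(2) by (simp add: v_def nth_eq_iff_index_eq)
      \<comment> \<open>Up to position \<open>i\<close> the exponents \<open>g\<close> and \<open>a\<close> agree, but at \<open>w\<close> they do not: \<open>w\<close> comes
        after \<open>v\<close>, so removing it does not spoil the lexicographic gain at \<open>v\<close>.\<close>
      moreover have "vs ! l \<noteq> w"
        using i(2)[OF l] w by auto
      ultimately show ?thesis
        using look[of "vs ! l"] by simp
    qed
    moreover have "Poly_Mapping.lookup g (vs ! i) < Poly_Mapping.lookup b (vs ! i)"
      using look[of v] \<open>w \<noteq> v\<close> by (simp add: v_def)
    ultimately have "key g < key b"
      unfolding key_def map_lookup_less_iff using i(1) by blast
    moreover have "b divides g + unit_exp v"
      using divides_add[of b "unit_exp w"] b(2) by simp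
    moreover have "0 < Poly_Mapping.lookup k v"
      using le_funD[OF a(3), of v] i(3) by (simp add: lookup_add v_def)
    moreover have "v \<in> V"
      using i(1) vs(1) by (auto simp: v_def)
    ultimately show ?thesis
      using b(1) by blast
  qed
  let ?gs = "map mono_of es :: ('v, 'k) mpoly list"
  show ?thesis
    unfolding has_linear_quotients_def
  proof (intro exI[of _ ?gs] conjI allI impI)
    show "distinct ?gs"
      using es(1) by (auto simp: distinct_map inj_on_def dest: arg_cong[of _ _ Poly_Mapping.keys])
    show "minimal_monomial_generators V (multiples V B) (set ?gs)"
      using minimal_monomial_generators_mono[OF V BV wt] es(2) by simp
    fix j assume j: "1 \<le> j \<and> j < length ?gs"
    define g where "g = es ! j"
    define A where "A = {b \<in> B. key g < key b}"
    define W where "W = {v \<in> V. \<exists>b\<in>A. b divides g + unit_exp v}"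
    have g: "g \<in> B"
      using j es(2) by (auto simp: g_def)
    have "set (take j es) = A"
      using set_take_decreasing_key[OF es(3)] j es(2) by (simp add: A_def g_def)
    then have "set (take j ?gs) = mono_of ` A"
      by (simp add: take_map)
    then have Idl: "Idl\<^bsub>poly_ring V\<^esub> (set (take j ?gs)) = multiples V A"
      using Idl_mono[of A V] BV by (auto simp: A_def)
    have "(\<exists>a\<in>A. a divides k + g) \<longleftrightarrow> (\<exists>v\<in>W. 0 < Poly_Mapping.lookup k v)" for k
    proof
      assume "\<exists>a\<in>A. a divides k + g"
      then show "\<exists>v\<in>W. 0 < Poly_Mapping.lookup k v"
        using exchange[OF g] by (force simp: A_def W_def)
    next
      assume "\<exists>v\<in>W. 0 < Poly_Mapping.lookup k v"
      then obtain v b where v: "0 < Poly_Mapping.lookup k v" "b \<in> A" "b divides g + unit_exp v"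
        by (auto simp: W_def)
      have "(g + unit_exp v) divides k + g"
        using v(1) by (auto simp: le_fun_def lookup_add lookup_unit_exp)
      then show "\<exists>a\<in>A. a divides k + g"
        using v(2,3) order.trans by blast
    qed
    then have "ideal_colon (poly_ring V) (multiples V A) (mono_of g)
        = Idl\<^bsub>poly_ring V\<^esub> (mvar ` W :: ('v, 'k) mpoly set)"
      by (intro colon_multiples) (use g BV in \<open>auto simp: W_def\<close>)
    then show "\<exists>W\<subseteq>V. ideal_colon (poly_ring V) (Idl\<^bsub>poly_ring V\<^esub> (set (take j ?gs))) (?gs ! j)
        = Idl\<^bsub>poly_ring V\<^esub> (mvar ` W)"
      using j unfolding Idl by (intro exI[of _ W]) (auto simp: g_def W_def)
  qed
qed

section \<open>Powers of edge ideals of complete multipartite graphs\<close>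

text \<open>
  A complete multipartite graph on \<open>V\<close> is given by a colouring \<open>c\<close>: the colour classes are the
  blocks, and two vertices are adjacent when their colours differ.
\<close>

definition block :: "'v set \<Rightarrow> ('v \<Rightarrow> 'c) \<Rightarrow> 'c \<Rightarrow> 'v set" where
  "block V c k = {v \<in> V. c v = k}"

definition edge_exps :: "'v set \<Rightarrow> ('v \<Rightarrow> 'c) \<Rightarrow> ('v \<Rightarrow>\<^sub>0 nat) set" where
  "edge_exps V c = {unit_exp u + unit_exp v | u v. u \<in> V \<and> v \<in> V \<and> c u \<noteq> c v}"

text \<open>
  The exponents of the generators of the \<open>n\<close>-th power of the edge ideal, described by inequalities;
  \<open>power_exps_0\<close> and \<open>power_exps_Suc\<close> justify the description.
\<close>

definition power_exps :: "'v set \<Rightarrow> ('v \<Rightarrow> 'c) \<Rightarrow> nat \<Rightarrow> ('v \<Rightarrow>\<^sub>0 nat) set" where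
  "power_exps V c n = {m \<in> exps V. wt V m = 2 * n \<and> (\<forall>k. wt (block V c k) m \<le> n)}"

lemma finite_block [simp]: "finite V \<Longrightarrow> finite (block V c k)"
  by (simp add: block_def)

text \<open>
  Increasing \<open>g\<close> at \<open>v\<close> can violate only the bound for the block of \<open>v\<close>, and only if that bound is
  attained. In that case \<open>a\<close> has no more weight on this block than \<open>g\<close>, so the compensating
  variable can be found inside the block; otherwise any compensating variable will do.
\<close>

lemma power_exps_polymatroidal:
  assumes V: "finite V"
  shows "polymatroidal V (2 * n) (power_exps V c n)"
  unfolding polymatroidal_def
proof (intro conjI ballI allI impI)
  show "power_exps V c n \<subseteq> exps V"
    by (auto simp: power_exps_def)
  show "wt V g = 2 * n" if "g \<in> power_exps V c n" for g
    using that by (simp add: power_exps_def)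
  fix g a v
  assume g: "g \<in> power_exps V c n" and a: "a \<in> power_exps V c n"
    and less: "Poly_Mapping.lookup g v < Poly_Mapping.lookup a v"
  have "v \<in> V"
    using a less by (auto simp: power_exps_def in_keys_iff subset_iff)
  define K where "K = block V c (c v)"
  define T where "T = (if wt K g < n then V else K)"
  have T: "finite T" "v \<in> T" "T \<subseteq> V"
    using V \<open>v \<in> V\<close> by (auto simp: T_def K_def block_def)
  have "wt T a \<le> wt T g"
    using g a by (auto simp: T_def K_def power_exps_def not_less intro: order.trans)
  then obtain w where w: "w \<in> T" "Poly_Mapping.lookup a w < Poly_Mapping.lookup g w"
    using wt_le_exchange[OF T(1) _ T(2) less] by blast
  define b where "b = g + unit_exp v - unit_exp w"
  have b: "b + unit_exp w = g + unit_exp v"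
    using w(2) by (intro poly_mapping_eqI) (auto simp: b_def lookup_add lookup_minus lookup_unit_exp)
  have wt_b: "wt A b + (if w \<in> A then 1 else 0) = wt A g + (if v \<in> A then 1 else 0)" if "A \<subseteq> V" for A
    using arg_cong[OF b, of "wt A"] finite_subset[OF that V] by (simp add: wt_add wt_unit_exp)
  have "b \<in> power_exps V c n"
    unfolding power_exps_def
  proof (intro CollectI conjI allI)
    have "Poly_Mapping.keys g \<subseteq> V"
      using g by (simp add: power_exps_def)
    then have "Poly_Mapping.keys (b + unit_exp w) \<subseteq> V"
      using \<open>v \<in> V\<close> by (simp add: b keys_plus)
    then show "Poly_Mapping.keys b \<subseteq> V"
      by (simp add: keys_plus)
    show "wt V b = 2 * n"
      using wt_b[of V] g w(1) T \<open>v \<in> V\<close> by (auto simp: power_exps_def)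
    fix k
    have sub: "block V c k \<subseteq> V"
      by (auto simp: block_def)
    have gk: "wt (block V c k) g \<le> n"
      using g by (simp add: power_exps_def)
    show "wt (block V c k) b \<le> n"
    proof (cases "k = c v")
      case False
      then have "v \<notin> block V c k"
        by (simp add: block_def)
      then show ?thesis
        using wt_b[OF sub] gk by (auto split: if_splits)
    next
      case True
      then have "wt K g < n \<or> w \<in> K"
        using w(1) by (auto simp: T_def split: if_splits)
      then show ?thesis
        using wt_b[OF sub] gk True by (auto simp: K_def split: if_splits)
    qed
  qed
  then show "\<exists>w. Poly_Mapping.lookup a w < Poly_Mapping.lookup g w \<and>
      (\<exists>b\<in>power_exps V c n. b + unit_exp w = g + unit_exp v)"
    using w(2) b by blast
qed

lemma obtain_maximizer:
  fixes f :: "'c \<Rightarrow> 'd::linorder"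
  assumes "finite S" "S \<noteq> {}"
  obtains x where "x \<in> S" "\<And>y. y \<in> S \<Longrightarrow> f y \<le> f x"
proof -
  have "Max (f ` S) \<in> f ` S"
    using assms by (intro Max_in) auto
  then obtain x where "x \<in> S" "f x = Max (f ` S)"
    by auto
  then show ?thesis
    using that assms(1) by (metis Max_ge finite_imageI imageI)
qed

text \<open>
  The edge to be removed joins a heaviest block to a heaviest block among the remaining ones. It has
  to lower the weight of every block of weight \<open>n + 1\<close>, and there is no third such block, since
  three of them would exceed the total \<open>2 (n + 1)\<close>.
\<close>

lemma power_exps_split_edge:
  assumes V: "finite V" and m: "m \<in> power_exps V c (Suc n)"
  obtains b e where "b \<in> power_exps V c n" "e \<in> edge_exps V c" "m = b + e"
proof -
  define S where "S = {v \<in> V. 0 < Poly_Mapping.lookup m v}"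
  define f where "f = (\<lambda>k. wt (block V c k) m)"
  have mV: "Poly_Mapping.keys m \<subseteq> V" and wtm: "wt V m = 2 * Suc n" and f_le: "\<And>k. f k \<le> Suc n"
    using m by (auto simp: power_exps_def f_def)
  have "finite S"
    using V by (simp add: S_def)
  have wt_pos: "\<exists>v\<in>A. 0 < Poly_Mapping.lookup m v" if "0 < wt A m" for A
    using that by (metis not_gr_zero sum.neutral wt_def)
  then have "S \<noteq> {}"
    using wt_pos[of V] unfolding wtm by (auto simp: S_def)
  obtain u where u: "u \<in> S" "\<And>t. t \<in> S \<Longrightarrow> f (c t) \<le> f (c u)"
    using obtain_maximizer[OF \<open>finite S\<close> \<open>S \<noteq> {}\<close>, of "\<lambda>t. f (c t)"] by blast
  have "wt V m = f (c u) + wt (V - block V c (c u)) m"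
    unfolding wt_def f_def using V by (intro sum.subset_diff[THEN trans, OF _ _ add.commute]) (auto simp: block_def)
  \<comment> \<open>A single block carries at most half of the total weight.\<close>
  then have "0 < wt (V - block V c (c u)) m"
    using wtm f_le[of "c u"] by simp
  then have ne: "{t \<in> S. c t \<noteq> c u} \<noteq> {}"
    using wt_pos[of "V - block V c (c u)"] by (auto simp: S_def block_def)
  have "finite {t \<in> S. c t \<noteq> c u}"
    using \<open>finite S\<close> by simp
  from obtain_maximizer[OF this ne, of "\<lambda>t. f (c t)"]
  obtain v where v: "v \<in> S" "c v \<noteq> c u" "\<And>t. t \<in> S \<Longrightarrow> c t \<noteq> c u \<Longrightarrow> f (c t) \<le> f (c v)"
    by (metis (mono_tags, lifting) mem_Collect_eq)
  have third: "f k \<le> n" if k: "k \<noteq> c u" "k \<noteq> c v" for k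
  proof (rule ccontr)
    assume "\<not> f k \<le> n"
    then have fk: "f k = Suc n"
      using f_le[of k] by simp
    then obtain t where "t \<in> S" "c t = k"
      using wt_pos[of "block V c k"] by (auto simp: f_def S_def block_def)
    then have "Suc n \<le> f (c u)" "Suc n \<le> f (c v)"
      using u(2)[of t] v(3)[of t] fk k(1) by auto
    moreover have "f k + f (c u) + f (c v) \<le> wt V m"
    proof -
      have "f k + f (c u) + f (c v) = wt (block V c k \<union> block V c (c u) \<union> block V c (c v)) m"
        unfolding f_def wt_def using V k v(2)
        by (subst sum.union_disjoint, auto simp: block_def)+
      also have "\<dots> \<le> wt V m"
        unfolding wt_def using V by (intro sum_mono2) (auto simp: block_def)
      finally show ?thesis .
    qed
    ultimately show False
      using fk wtm by simp
  qed
  define e where "e = unit_exp u + unit_exp v"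
  have "u \<noteq> v"
    using v(2) by auto
  then have "e divides m"
    using u(1) v(1) by (auto simp: e_def S_def le_fun_def lookup_add lookup_unit_exp)
  then have meq: "m = (m - e) + e"
    using divides_decompose[of e m] by (simp add: add.commute)
  have e: "e \<in> edge_exps V c"
    using u(1) v(1,2) by (force simp: e_def edge_exps_def S_def)
  have wt_m: "wt A m = wt A (m - e) + (if u \<in> A then 1 else 0) + (if v \<in> A then 1 else 0)" if "A \<subseteq> V" for A
    using arg_cong[OF meq, of "wt A"] finite_subset[OF that V] by (simp add: wt_add wt_unit_exp e_def)
  have "m - e \<in> power_exps V c n"
    unfolding power_exps_def
  proof (intro CollectI conjI allI)
    show "Poly_Mapping.keys (m - e) \<subseteq> V"
      using mV meq keys_plus[of "m - e" e] by auto
    show "wt V (m - e) = 2 * n"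
      using wt_m[of V] wtm u(1) v(1) by (simp add: S_def)
    fix k
    have sub: "block V c k \<subseteq> V"
      by (auto simp: block_def)
    show "wt (block V c k) (m - e) \<le> n"
    proof (cases "k = c u \<or> k = c v")
      case True
      then have "u \<in> block V c k \<or> v \<in> block V c k"
        using u(1) v(1) by (auto simp: block_def S_def)
      then show ?thesis
        using wt_m[OF sub] f_le[of k] by (auto simp: f_def split: if_splits)
    next
      case False
      then show ?thesis
        using third[of k] wt_m[OF sub] by (simp add: f_def)
    qed
  qed
  then show ?thesis
    using that e meq by blast
qed

lemma power_exps_Suc:
  assumes V: "finite V"
  shows "power_exps V c (Suc n) = {b + e | b e. b \<in> power_exps V c n \<and> e \<in> edge_exps V c}"
proof (intro equalityI subsetI)
  fix m assume "m \<in> power_exps V c (Suc n)"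
  then show "m \<in> {b + e | b e. b \<in> power_exps V c n \<and> e \<in> edge_exps V c}"
    using power_exps_split_edge[OF V] by blast
next
  fix m assume "m \<in> {b + e | b e. b \<in> power_exps V c n \<and> e \<in> edge_exps V c}"
  then obtain b u v where b: "b \<in> power_exps V c n" and uv: "u \<in> V" "v \<in> V" "c u \<noteq> c v"
    and m: "m = b + (unit_exp u + unit_exp v)"
    by (auto simp: edge_exps_def)
  have wt_m: "wt A m = wt A b + (if u \<in> A then 1 else 0) + (if v \<in> A then 1 else 0)" if "A \<subseteq> V" for A
    using finite_subset[OF that V] by (simp add: m wt_add wt_unit_exp)
  show "m \<in> power_exps V c (Suc n)"
    unfolding power_exps_def
  proof (intro CollectI conjI allI)
    show "Poly_Mapping.keys m \<subseteq> V"
      using b uv by (simp add: m keys_plus power_exps_def)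
    show "wt V m = 2 * Suc n"
      using wt_m[of V] b uv by (simp add: power_exps_def)
    fix k
    have "\<not> (u \<in> block V c k \<and> v \<in> block V c k)"
      using uv(3) by (auto simp: block_def)
    moreover have "wt (block V c k) b \<le> n"
      using b by (simp add: power_exps_def)
    ultimately show "wt (block V c k) m \<le> Suc n"
      using wt_m[of "block V c k"] by (auto simp: block_def split: if_splits)
  qed
qed

lemma power_exps_0:
  assumes "finite V"
  shows "power_exps V c 0 = {0}"
proof -
  have "m = 0" if "m \<in> power_exps V c 0" for m
    using divides_same_wt_eq[OF assms, of 0 m] that by (simp add: power_exps_def le_fun_def wt_def)
  then show ?thesis
    by (auto simp: power_exps_def wt_def)
qed

lemma pow_edge_ideal_multiples:
  fixes V :: "'v set" and n :: nat
  assumes V: "finite V"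
  shows "(multiples V (edge_exps V c) :: ('v, 'k::comm_ring_1) mpoly set)
    [^]\<^bsub>ideals_set (poly_ring V)\<^esub> n = multiples V (power_exps V c n)"
proof (induction n)
  case 0
  have "multiples V {0} = carrier (poly_ring V :: ('v, 'k) mpoly ring)"
    by (auto simp: multiples_def le_fun_def)
  then show ?case
    by (simp add: power_exps_0[OF V] nat_pow_def ideals_set_def)
next
  case (Suc n)
  have "edge_exps V c \<subseteq> exps V" "power_exps V c n \<subseteq> exps V"
    by (auto simp: edge_exps_def power_exps_def keys_plus)
  then show ?case
    using Suc ideal_prod_multiples[of "power_exps V c n" V "edge_exps V c"]
    by (simp add: nat_pow_def ideals_set_def power_exps_Suc[OF V])
qed

theorem complete_multipartite_pow_linear_quotients:
  fixes V :: "'v set" and c :: "'v \<Rightarrow> 'c" and n :: nat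
  assumes V: "finite V" and E: "\<And>u v. {u, v} \<in> E \<longleftrightarrow> u \<in> V \<and> v \<in> V \<and> c u \<noteq> c v"
  shows "has_linear_quotients V
    ((edge_ideal V E :: ('v, 'k::comm_ring_1) mpoly set) [^]\<^bsub>ideals_set (poly_ring V)\<^esub> n)"
proof -
  have "mvar u * mvar v = (mono_of (unit_exp u + unit_exp v) :: ('v, 'k) mpoly)" for u v
    by (simp add: mvar_eq_mono mult_single)
  moreover have "edge_exps V c = {unit_exp u + unit_exp v | u v. {u, v} \<in> E}"
    by (simp only: edge_exps_def E)
  ultimately have "{mvar u * mvar v | u v. {u, v} \<in> E} = (mono_of ` edge_exps V c :: ('v, 'k) mpoly set)"
    by (simp only:) blast
  moreover have "edge_exps V c \<subseteq> exps V"
    by (auto simp: edge_exps_def keys_plus)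
  ultimately have "edge_ideal V E = (multiples V (edge_exps V c) :: ('v, 'k) mpoly set)"
    unfolding edge_ideal_def by (simp add: Idl_mono)
  then show ?thesis
    using polymatroidal_linear_quotients[OF V power_exps_polymatroidal[OF V]]
    by (simp add: pow_edge_ideal_multiples[OF V])
qed

section \<open>The prime ideal graph\<close>

text \<open>
  The colour of the block outside \<open>P\<close> is \<open>\<zero>\<close>. It differs from the colours of the blocks inside
  \<open>P\<close>, which are their own elements, because \<open>\<zero>\<close> is not a vertex.
\<close>

lemma prime_ideal_graph_edges_iff:
  assumes R: "cring R" and P: "primeideal P R"
  shows "{u, v} \<in> prime_ideal_graph_edges R P \<longleftrightarrow>
    u \<in> prime_ideal_graph_verts R \<and> v \<in> prime_ideal_graph_verts R \<and>
    (if u \<in> P then u else \<zero>\<^bsub>R\<^esub>) \<noteq> (if v \<in> P then v else \<zero>\<^bsub>R\<^esub>)"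
proof -
  interpret cring R by (rule R)
  interpret primeideal P R by (rule P)
  have edge: "{u, v} \<in> prime_ideal_graph_edges R P \<longleftrightarrow> u \<in> prime_ideal_graph_verts R \<and>
      v \<in> prime_ideal_graph_verts R \<and> u \<noteq> v \<and> u \<otimes>\<^bsub>R\<^esub> v \<in> P"
  proof
    assume "{u, v} \<in> prime_ideal_graph_edges R P"
    then obtain x y where xy: "{u, v} = {x, y}" "x \<in> prime_ideal_graph_verts R"
      "y \<in> prime_ideal_graph_verts R" "x \<noteq> y" "x \<otimes>\<^bsub>R\<^esub> y \<in> P"
      by (auto simp: prime_ideal_graph_edges_def)
    moreover have "y \<otimes>\<^bsub>R\<^esub> x \<in> P"
      using xy m_comm[of x y] by (simp add: prime_ideal_graph_verts_def)
    ultimately show "u \<in> prime_ideal_graph_verts R \<and> v \<in> prime_ideal_graph_verts R \<and> u \<noteq> v \<and>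
        u \<otimes>\<^bsub>R\<^esub> v \<in> P"
      by (auto simp: doubleton_eq_iff)
  qed (auto simp: prime_ideal_graph_edges_def)
  have "u \<otimes>\<^bsub>R\<^esub> v \<in> P \<longleftrightarrow> u \<in> P \<or> v \<in> P" if "u \<in> carrier R" "v \<in> carrier R"
    using I_prime[OF that] I_l_closed[OF _ that(1), of v] I_r_closed[OF _ that(2), of u] by blast
  then show ?thesis
    unfolding edge by (auto simp: prime_ideal_graph_verts_def)
qed

theorem corollary6p5:
  fixes R :: "('a, 'b) ring_scheme" and P :: "'a set" and n :: nat
    and S :: "('a, 'k::field) mpoly ring" and I :: "('a, 'k) mpoly set"
  assumes "cring R" and "finite (carrier R)"
    and "primeideal P R" and "card P \<ge> 2"
    and "S = poly_ring (prime_ideal_graph_verts R)"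
    and "I = edge_ideal (prime_ideal_graph_verts R) (prime_ideal_graph_edges R P)"
    and "n \<ge> 1"
  shows "has_linear_quotients (prime_ideal_graph_verts R) (I [^]\<^bsub>ideals_set S\<^esub> n)"
  unfolding assms(5,6)
proof (rule complete_multipartite_pow_linear_quotients)
  show "finite (prime_ideal_graph_verts R)"
    using assms(2) by (simp add: prime_ideal_graph_verts_def)
qed (rule prime_ideal_graph_edges_iff[OF assms(1,3)])

end
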